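(* Let $K$ be a nonempty compact metric space, let $L=C(K)$ be the real vector space of continuous functions $K\to\mathbb{R}$ with the uniform norm, and let $L'$ be the space of continuous real-valued linear functionals on $L$. Let $m\colon L\to\mathbb{R}$, $m(f)=\max_{t\in K} f(t)$. For $f\in L$ put $\operatorname{Argmax}_K f = K_f=\{t\in K: f(t)=m(f)\}$, let $$\partial m_f=\{h\in L' : m(g)-m(f)\ge h(g-f)\ \text{ for all } g\in L\}$$ be the sub-gradient (subdifferential) of $m$ at $f$, and let $\mathcal{P}_f\subset L'$ be the set of all probability measures on $K$ concentrated on $K_f$, where each measure $\mu$ is identified with the functional $x\mapsto\int_K x(t)\,\mu(dt)$ on $L$. Then for every $f\in L$, $$\partial m_f=\mathcal{P}_f .$$ Equivalently, for every $f\in L$, a functional $h\in L'$ satisfies $m(g)-m(f)\ge h(g-f)$ for all $g\in L$ if and only if there is a Borel probability measure $\mu$ on $K$ concentrated on $K_f$ such that $h(x)=\int_K x(t)\,\mu(dt)$ for all $x\in L$.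
   Context: The uniform norm on $L=C(K)$ is $\|x\|=\sup_{t\in K}|x(t)|$, and $L'$ carries the operator norm. Let $\mathcal{A}$ be the $\sigma$-algebra of Borel subsets of $K$ and $\mathfrak{M}(K)$ the space of all real-valued (finite, signed) $\sigma$-additive Borel measures on $K$ with the variation norm. By the Riesz–Markov theorem, the map sending $\mu\in\mathfrak{M}(K)$ to the functional $x\mapsto\int_K x(t)\,\mu(dt)$ is an isomorphism of normed spaces $\mathfrak{M}(K)\to L'$, and $\mathfrak{M}(K)$ is identified with $L'$ via this map. The set of probability measures concentrated on $K_f$ is $$\mathcal{P}_f=\{\mu\in\mathfrak{M}(K): \mu(K_f)=1,\ \mu(A)\ge 0 \text{ and } \mu(A)=\mu(A\cap K_f)\ \text{ for all } A\in\mathcal{A}\},$$ regarded as a subset of $L'$ through this identification. *)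

theory Defs
  imports "HOL-Probability.Probability"
begin

text \<open>
  The compact metric space \<open>K\<close> is the universe of a type \<open>'a :: metric_space\<close>, with compactness of
  \<open>UNIV\<close> assumed where needed; nonemptiness is automatic. For compact \<open>K\<close> every continuous
  function is bounded, so \<open>'a \<Rightarrow>\<^sub>C real\<close> is \<open>C(K)\<close> with the uniform norm,
  and \<open>('a \<Rightarrow>\<^sub>C real) \<Rightarrow>\<^sub>L real\<close> is its dual with the operator norm.
\<close>

text \<open>
  \<open>Greatest\<close> is meaningful only if the range has a largest element; the lemmas below
  show that this is so on a compact space.
\<close>

definition max_value :: "('a::metric_space \<Rightarrow>\<^sub>C real) \<Rightarrow> real" where
  "max_value f = (GREATEST v. v \<in> range (apply_bcontfun f))"

definition Argmax :: "('a::metric_space \<Rightarrow>\<^sub>C real) \<Rightarrow> 'a set" where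
  "Argmax f = {t. apply_bcontfun f t = max_value f}"

definition subdifferential :: "('v::real_normed_vector \<Rightarrow> real) \<Rightarrow> 'v \<Rightarrow> ('v \<Rightarrow>\<^sub>L real) set" where
  "subdifferential F f = {h. \<forall>g. F g - F f \<ge> blinfun_apply h (g - f)}"

text \<open>
  A nonnegative finite signed Borel measure is the same thing as a finite \<open>'a measure\<close> on the
  Borel sets, so the condition \<open>\<mu>(A) \<ge> 0\<close> is built into the type.
\<close>

definition prob_measures_on :: "'a::topological_space set \<Rightarrow> 'a measure set" where
  "prob_measures_on S = {M. sets M = sets borel \<and> prob_space M \<and> measure M S = 1 \<and>
     (\<forall>A\<in>sets borel. measure M A = measure M (A \<inter> S))}"

text \<open>
  Measures enter the dual space through the Riesz--Markov identification
  \<open>\<mu> \<mapsto> (x \<mapsto> \<integral> x d\<mu>)\<close>.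
\<close>

definition prob_functionals :: "('a::metric_space \<Rightarrow>\<^sub>C real) \<Rightarrow> (('a \<Rightarrow>\<^sub>C real) \<Rightarrow>\<^sub>L real) set" where
  "prob_functionals f =
     {h. \<exists>M\<in>prob_measures_on (Argmax f). \<forall>x. blinfun_apply h x = (\<integral>t. apply_bcontfun x t \<partial>M)}"

lemma max_value_properties:
  fixes f :: "'a::metric_space \<Rightarrow>\<^sub>C real"
  assumes "compact (UNIV :: 'a set)"
  shows max_value_attained: "max_value f \<in> range (apply_bcontfun f)"
    and max_value_upper: "apply_bcontfun f t \<le> max_value f"
proof -
  have "continuous_on UNIV (apply_bcontfun f)"
    using apply_bcontfun[of f] by (simp add: bcontfun_def)
  then obtain s where s: "\<And>t. apply_bcontfun f t \<le> apply_bcontfun f s"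
    using continuous_attains_sup[OF assms] by blast
  have "max_value f = apply_bcontfun f s"
    unfolding max_value_def by (rule Greatest_equality) (use s in auto)
  then show "max_value f \<in> range (apply_bcontfun f)" "apply_bcontfun f t \<le> max_value f"
    using s by auto
qed

end

theory Submission
  imports Defs
begin

text \<open>
  Why the theorem holds. Write \<open>m\<close> for the maximum functional. If \<open>h\<close> is a subgradient of \<open>m\<close> at
  \<open>f\<close>, then \<open>h x \<le> m (f + x) - m f\<close> for every \<open>x\<close>, and a few choices of \<open>x\<close> determine the nature of
  \<open>h\<close>: a nonpositive \<open>x\<close> gives \<open>h x \<le> 0\<close>, so \<open>h\<close> is positive; \<open>x = 1\<close> and \<open>x = -1\<close> give \<open>h 1 = 1\<close>;
  \<open>x = f\<close> and \<open>x = -f\<close> give \<open>h f = m f\<close> (\<open>subgradient_positive_normalized\<close>). By the Riesz--Markov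
  theorem \<open>h\<close> is integration against a Borel probability measure \<open>M\<close>. The last equation then says that
  the nonnegative function \<open>m f - f\<close> has integral \<open>0\<close>, which means that \<open>M\<close> lives on the set where
  \<open>f\<close> attains its maximum (\<open>prob_measures_on_Argmax_iff\<close>). Conversely, if \<open>M\<close> is such a measure, then
  the integral of \<open>g\<close> is at most \<open>m g\<close> while that of \<open>f\<close> equals \<open>m f\<close>; subtracting gives the
  subgradient inequality.

  The Riesz--Markov theorem is proved for a positive normalized functional \<open>I\<close> on the continuous
  functions of a compact metric space. An open set \<open>U\<close> is measured from inside by the
  supremum of \<open>I x\<close> over continuous \<open>x\<close> with \<open>0 \<le> x \<le> indicator U\<close>, and an arbitrary set from outside by
  open supersets. Compactness makes this countably subadditive (\<open>inner_content_UN_le\<close>), and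
  open sets satisfy the Caratheodory criterion (\<open>inner_content_ge_parts\<close>), so a Borel measure results.
  Slicing a function horizontally yields \<open>I x \<le> \<integral> x\<close> (\<open>le_integral_unit\<close>); applied to \<open>x\<close> and \<open>-x\<close>, this
  one inequality already gives equality.
\<close>

section \<open>Auxiliary facts on continuous functions\<close>

lemma open_eq_positivity_set:
  fixes U :: "'a::metric_space set"
  assumes "open U"
  obtains d :: "'a \<Rightarrow> real"
    where "continuous_on UNIV d" "\<And>t. 0 \<le> d t" "\<And>t. 0 < d t \<longleftrightarrow> t \<in> U"
proof (cases "U = UNIV")
  case True
  \<comment> \<open>The distance to the empty complement is \<open>0\<close> by convention, so this case is separate.\<close>
  then show ?thesis
    by (intro that[of "\<lambda>_. 1"]) auto
next
  case False
  show ?thesis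
  proof (rule that[of "\<lambda>t. infdist t (- U)"])
    show "continuous_on UNIV (\<lambda>t. infdist t (- U))"
      by (intro continuous_intros)
    show "0 < infdist t (- U) \<longleftrightarrow> t \<in> U" for t
      using False assms infdist_pos_not_in_closed[of "- U" t]
      by (cases "t \<in> U") auto
  qed (rule infdist_nonneg)
qed

lemma integrable_bounded_continuous:
  fixes x :: "'a::topological_space \<Rightarrow> real"
  assumes M: "prob_space M" "sets M = sets borel"
    and x: "continuous_on UNIV x" "bounded (range x)"
  shows "integrable M x"
proof -
  interpret prob_space M by (rule M)
  obtain B where "norm (x t) \<le> B" for t
    using x(2) by (auto simp: bounded_iff)
  then have "AE t in M. norm (x t) \<le> B"
    by simp
  moreover have "x \<in> borel_measurable M"
    using borel_measurable_continuous_onI[OF x(1)] measurable_cong_sets[OF M(2) refl] by blast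
  ultimately show ?thesis
    by (rule integrable_const_bound)
qed

section \<open>The outer measure of a positive functional\<close>

text \<open>
  The functional takes plain functions rather than elements of the type of bounded continuous functions:
  its argument can then be written as a lambda term, and continuity becomes a side condition that
  the introduction rules for continuity discharge. Its values on discontinuous functions are
  arbitrary.
\<close>

locale positive_normalized_functional =
  fixes I :: "('a::metric_space \<Rightarrow> real) \<Rightarrow> real"
  assumes compact: "compact (UNIV :: 'a set)"
    and add: "continuous_on UNIV x \<Longrightarrow> continuous_on UNIV y \<Longrightarrow> I (\<lambda>t. x t + y t) = I x + I y"
    and scale: "continuous_on UNIV x \<Longrightarrow> I (\<lambda>t. c * x t) = c * I x"
    and nonneg: "continuous_on UNIV x \<Longrightarrow> (\<And>t. 0 \<le> x t) \<Longrightarrow> 0 \<le> I x"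
    and one: "I (\<lambda>_. 1) = 1"
begin

lemma const: "I (\<lambda>_. c) = c"
  using scale[of "\<lambda>_. 1" c] one by simp

lemma mono:
  assumes "continuous_on UNIV x" "continuous_on UNIV y" "\<And>t. x t \<le> y t"
  shows "I x \<le> I y"
proof -
  have c: "continuous_on UNIV (\<lambda>t. y t - x t)"
    using assms by (intro continuous_intros)
  have "I y = I (\<lambda>t. x t + (y t - x t))" by simp
  also have "\<dots> = I x + I (\<lambda>t. y t - x t)"
    using assms(1) c by (rule add)
  finally show ?thesis
    using nonneg[OF c] assms(3) by simp
qed

lemma sum:
  assumes "\<And>i. i \<in> S \<Longrightarrow> continuous_on UNIV (x i)"
  shows "I (\<lambda>t. \<Sum>i\<in>S. x i t) = (\<Sum>i\<in>S. I (x i))"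
  using assms
proof (induction S rule: infinite_finite_induct)
  case (insert i S)
  then have "I (\<lambda>t. x i t + (\<Sum>i\<in>S. x i t)) = I (x i) + I (\<lambda>t. \<Sum>i\<in>S. x i t)"
    by (intro add continuous_intros) auto
  with insert show ?case by simp
qed (simp_all add: const)

definition below :: "'a set \<Rightarrow> ('a \<Rightarrow> real) set" where
  "below U = {x. continuous_on UNIV x \<and> (\<forall>t. 0 \<le> x t \<and> x t \<le> indicator U t)}"

definition inner_content :: "'a set \<Rightarrow> ennreal" where
  "inner_content U = (SUP x\<in>below U. ennreal (I x))"

definition outer :: "'a set \<Rightarrow> ennreal" where
  "outer A = (INF U\<in>{U. open U \<and> A \<subseteq> U}. inner_content U)"

lemma belowD:
  assumes "x \<in> below U"
  shows "continuous_on UNIV x" "0 \<le> x t" "x t \<le> 1" "t \<notin> U \<Longrightarrow> x t = 0" "0 \<le> I x" "I x \<le> 1"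
proof -
  show c: "continuous_on UNIV x" and p: "0 \<le> x t" for t
    using assms by (auto simp: below_def)
  have i: "x t \<le> indicator U t" for t
    using assms by (auto simp: below_def)
  show l: "x t \<le> 1" for t
    using order_trans[OF i, of t 1] by (simp add: indicator_def)
  show "t \<notin> U \<Longrightarrow> x t = 0"
    using i[of t] p[of t] by simp
  show "0 \<le> I x"
    using c p by (rule nonneg)
  show "I x \<le> 1"
    using mono[OF c _ l] by (simp add: one)
qed

lemma belowI:
  assumes "continuous_on UNIV x" "\<And>t. 0 \<le> x t" "\<And>t. x t \<le> 1" "\<And>t. t \<notin> U \<Longrightarrow> x t = 0"
  shows "x \<in> below U"
  using assms by (auto simp: below_def indicator_def)

lemma zero_below: "(\<lambda>_. 0) \<in> below U"
  by (rule belowI) auto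

lemma le_inner_content: "x \<in> below U \<Longrightarrow> ennreal (I x) \<le> inner_content U"
  unfolding inner_content_def by (rule SUP_upper)

lemma inner_content_mono: "U \<subseteq> V \<Longrightarrow> inner_content U \<le> inner_content V"
  unfolding inner_content_def by (rule SUP_subset_mono) (auto intro!: belowI dest: belowD)

lemma inner_content_empty: "inner_content {} = 0"
proof -
  have "below {} = {\<lambda>_. 0}"
    using zero_below by (auto dest: belowD(4))
  then show ?thesis
    by (simp add: inner_content_def const)
qed

lemma inner_content_UNIV: "inner_content UNIV = 1"
proof (rule antisym)
  show "inner_content UNIV \<le> 1"
    unfolding inner_content_def by (intro SUP_least) (auto dest: belowD)
  show "1 \<le> inner_content UNIV"
    using le_inner_content[OF belowI, of "\<lambda>_. 1" UNIV] by (simp add: one)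
qed

lemma outer_le_inner_content: "open U \<Longrightarrow> A \<subseteq> U \<Longrightarrow> outer A \<le> inner_content U"
  unfolding outer_def by (auto intro: INF_lower)

lemma outer_open: "open U \<Longrightarrow> outer U = inner_content U"
  by (intro antisym outer_le_inner_content) (auto simp: outer_def intro!: INF_greatest inner_content_mono)

lemma outer_mono: "A \<subseteq> B \<Longrightarrow> outer A \<le> outer B"
  unfolding outer_def by (rule INF_superset_mono) auto

text \<open>
  This is where compactness enters. If \<open>x\<close> lies below the union, the compact set where \<open>x \<ge> e\<close> is
  covered by the increasing open sets on which \<open>N * d i\<close> exceeds \<open>1\<close> for some \<open>i < N\<close>; hence one \<open>N\<close>
  suffices, and \<open>x\<close> is at most \<open>e\<close> plus finitely many functions, each below one of the \<open>U i\<close>.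
\<close>

lemma inner_content_UN_le:
  fixes U :: "nat \<Rightarrow> 'a set"
  assumes "\<And>i. open (U i)"
  shows "inner_content (\<Union>i. U i) \<le> (\<Sum>i. inner_content (U i))"
proof -
  obtain d :: "nat \<Rightarrow> 'a \<Rightarrow> real"
    where d: "\<And>i. continuous_on UNIV (d i)" "\<And>i t. 0 \<le> d i t" "\<And>i t. 0 < d i t \<longleftrightarrow> t \<in> U i"
  proof -
    have "\<forall>i. \<exists>d :: 'a \<Rightarrow> real. continuous_on UNIV d \<and> (\<forall>t. 0 \<le> d t) \<and> (\<forall>t. 0 < d t \<longleftrightarrow> t \<in> U i)"
      using open_eq_positivity_set[OF assms] by metis
    then show thesis
      using that by metis
  qed
  have approx: "ennreal (I x) \<le> (\<Sum>i. inner_content (U i)) + ennreal e"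
    if x: "x \<in> below (\<Union>i. U i)" and e: "0 < e" for x e
  proof -
    note cx = belowD(1)[OF x]
    \<comment> \<open>The set where \<open>x < e\<close> is included so that the \<open>C N\<close> cover the whole space.\<close>
    define C where "C N = {t. x t < e} \<union> (\<Union>i<N. {t. 1 < real N * d i t})" for N
    have open_C: "open (C N)" for N
      unfolding C_def by (intro open_Un open_UN ballI open_Collect_less continuous_intros cx d(1))
    have cover: "UNIV \<subseteq> (\<Union>N. C N)"
    proof
      fix t
      show "t \<in> (\<Union>N. C N)"
      proof (cases "x t < e")
        case False
        then obtain i where i: "0 < d i t"
          using belowD(4)[OF x, of t] e d(3) by fastforce
        obtain m where m: "1 < real m * d i t"
          using reals_Archimedean3[OF i] by blast
        have "real m * d i t \<le> real (max m (Suc i)) * d i t"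
          using i by (intro mult_right_mono) auto
        with m have "t \<in> C (max m (Suc i))"
          by (auto simp: C_def intro!: bexI[of _ i])
        then show ?thesis by blast
      qed (auto simp: C_def)
    qed
    obtain T where T: "finite T" "UNIV \<subseteq> (\<Union>N\<in>T. C N)"
      by (rule compactE_image[OF compact open_C cover])
    have C_mono: "C m \<subseteq> C n" if "m \<le> n" for m n
    proof
      fix t assume "t \<in> C m"
      moreover have "1 < real n * d i t" if "1 < real m * d i t" for i
        using that \<open>m \<le> n\<close> d(2)[of i t]
        by (elim less_le_trans) (intro mult_right_mono, auto)
      ultimately show "t \<in> C n"
        using that by (force simp: C_def)
    qed
    obtain N where N: "\<And>n. n \<in> T \<Longrightarrow> n \<le> N"
      using T(1) by (auto simp: finite_nat_set_iff_bounded_le)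
    have CN: "t \<in> C N" for t
    proof -
      obtain n where "n \<in> T" "t \<in> C n"
        using T(2) by auto
      then show ?thesis
        using C_mono[OF N] by auto
    qed
    define y where "y i t = min 1 (real N * d i t)" for i t
    have y: "y i \<in> below (U i)" for i
      using d by (auto simp: y_def intro!: belowI continuous_intros) (metis less_eq_real_def mult_eq_0_iff min.absorb2 zero_le_one)
    have le: "x t \<le> e + (\<Sum>i<N. y i t)" for t
    proof (cases "x t < e")
      case True
      then show ?thesis
        using sum_nonneg[of "{..<N}" "\<lambda>i. y i t"] belowD(2)[OF y] by fastforce
    next
      case False
      then obtain i where "i < N" "1 < real N * d i t"
        using CN[of t] by (auto simp: C_def)
      then have "1 \<le> (\<Sum>i<N. y i t)"
        using member_le_sum[of i "{..<N}" "\<lambda>i. y i t"] belowD(2)[OF y] by (simp add: y_def)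
      then show ?thesis
        using belowD(3)[OF x, of t] e by linarith
    qed
    have cs: "continuous_on UNIV (\<lambda>t. \<Sum>i<N. y i t)"
      by (intro continuous_intros belowD(1)[OF y])
    have "I x \<le> I (\<lambda>t. e + (\<Sum>i<N. y i t))"
      using le by (intro mono cx continuous_on_add cs continuous_on_const)
    also have "\<dots> = e + (\<Sum>i<N. I (y i))"
      using cs belowD(1)[OF y] by (simp add: add const sum)
    finally have "ennreal (I x) \<le> ennreal e + (\<Sum>i<N. ennreal (I (y i)))"
      using belowD(5)[OF y] e
      by (simp add: sum_ennreal sum_nonneg flip: ennreal_plus)
    also have "\<dots> \<le> ennreal e + (\<Sum>i<N. inner_content (U i))"
      by (intro add_left_mono sum_mono le_inner_content y)
    also have "\<dots> \<le> ennreal e + (\<Sum>i. inner_content (U i))"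
      by (intro add_left_mono sum_le_suminf) auto
    finally show ?thesis by (simp add: add.commute)
  qed
  show ?thesis
    unfolding inner_content_def[of "\<Union>i. U i"]
    by (rule SUP_least, rule ennreal_le_epsilon, rule approx)
qed

lemma outer_measure_space_outer: "outer_measure_space UNIV outer"
  unfolding outer_measure_space_def
proof (intro conjI)
  show "positive UNIV outer"
    by (simp add: positive_def outer_open inner_content_empty)
  show "increasing UNIV outer"
    by (simp add: increasing_def outer_mono)
  show "countably_subadditive UNIV outer"
    unfolding countably_subadditive_def
  proof (intro allI impI)
    fix A :: "nat \<Rightarrow> 'a set"
    show "outer (\<Union>i. A i) \<le> (\<Sum>i. outer (A i))"
    proof (rule ennreal_le_epsilon)
      fix e :: real assume e: "0 < e" "(\<Sum>i. outer (A i)) < top"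
      have "\<exists>U. open U \<and> A i \<subseteq> U \<and> inner_content U < outer (A i) + e * (1/2) ^ Suc i" for i
      proof -
        have "outer (A i) < outer (A i) + e * (1/2) ^ Suc i"
          using e by (auto simp: less_top dest!: ennreal_suminf_lessD)
        then show ?thesis
          by (subst (asm) outer_def) (auto simp: INF_less_iff)
      qed
      then obtain U where U: "\<And>i. open (U i)" "\<And>i. A i \<subseteq> U i"
        "\<And>i. inner_content (U i) < outer (A i) + e * (1/2) ^ Suc i"
        by metis
      have "outer (\<Union>i. A i) \<le> inner_content (\<Union>i. U i)"
        using U by (intro outer_le_inner_content) auto
      also have "\<dots> \<le> (\<Sum>i. inner_content (U i))"
        using U(1) by (rule inner_content_UN_le)
      also have "\<dots> \<le> (\<Sum>i. outer (A i) + e * (1/2) ^ Suc i)"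
        using U(3) by (intro suminf_le less_imp_le) auto
      also have "\<dots> = (\<Sum>i. outer (A i)) + (\<Sum>i. ennreal e * ennreal ((1/2) ^ Suc i))"
        using \<open>0 < e\<close> by (subst suminf_add[symmetric])
          (auto simp del: ennreal_suminf_cmult simp add: ennreal_mult[symmetric])
      also have "\<dots> = (\<Sum>i. outer (A i)) + e"
        unfolding ennreal_suminf_cmult
        by (subst suminf_ennreal_eq[OF zero_le_power power_half_series]) auto
      finally show "outer (\<Union>i. A i) \<le> (\<Sum>i. outer (A i)) + e" .
    qed
  qed
qed

text \<open>
  The Caratheodory inequality for the open set \<open>U\<close>, tested on an open set \<open>V\<close>. Given \<open>x\<close> below
  \<open>V \<inter> U\<close>, the set \<open>V - U\<close> is contained in the open set \<open>W\<close> of points of \<open>V\<close> with \<open>x < e\<close>. For \<open>y\<close> below \<open>W\<close> the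
  sum \<open>x + y\<close> exceeds \<open>1\<close> by at most \<open>e\<close>, so up to the factor \<open>1 + e\<close> it lies below \<open>V\<close>.
\<close>

lemma inner_content_ge_parts:
  assumes U: "open U" and V: "open V"
  shows "inner_content (V \<inter> U) + outer (V - U) \<le> inner_content V"
proof -
  have "ennreal (I x) + outer (V - U) \<le> inner_content V" if x: "x \<in> below (V \<inter> U)" for x
  proof (rule ennreal_le_epsilon)
    fix e :: real assume e: "0 < e"
    define W where "W = V \<inter> {t. x t < e}"
    have W: "open W"
      unfolding W_def by (intro open_Int V open_Collect_less continuous_intros belowD(1)[OF x])
    have "V - U \<subseteq> W"
      using belowD(4)[OF x] e by (auto simp: W_def)
    then have "ennreal (I x) + outer (V - U) \<le> ennreal (I x) + inner_content W"
      by (intro add_left_mono outer_le_inner_content W)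
    also have "\<dots> = (SUP y\<in>below W. ennreal (I x) + ennreal (I y))"
      unfolding inner_content_def using zero_below by (subst ennreal_SUP_add_right) auto
    also have "\<dots> \<le> inner_content V + ennreal e"
    proof (rule SUP_least)
      fix y assume y: "y \<in> below W"
      note c = belowD(1)[OF x] belowD(1)[OF y]
      define z where "z t = (1 / (1 + e)) * (x t + y t)" for t
      have z: "z \<in> below V"
      proof (rule belowI)
        show "continuous_on UNIV z"
          unfolding z_def by (intro continuous_intros c)
        show "0 \<le> z t" for t
          using belowD(2)[OF x, of t] belowD(2)[OF y, of t] e by (simp add: z_def)
        show "t \<notin> V \<Longrightarrow> z t = 0" for t
          using belowD(4)[OF x, of t] belowD(4)[OF y, of t] by (simp add: z_def W_def)
        have "x t + y t \<le> 1 + e" for t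
          using belowD(3)[OF x, of t] belowD(3)[OF y, of t] belowD(4)[OF y, of t] e
          by (cases "t \<in> W") (auto simp: W_def)
        then show "z t \<le> 1" for t
          using e by (simp add: z_def divide_simps)
      qed
      have "I z = (1 / (1 + e)) * (I x + I y)"
        unfolding z_def using c by (subst scale) (auto intro!: continuous_intros simp: add)
      then have "I x + I y = I z + e * I z"
        using e by (simp add: field_simps)
      also have "\<dots> \<le> I z + e"
        using belowD(6)[OF z] e by simp
      finally have "ennreal (I x) + ennreal (I y) \<le> ennreal (I z) + ennreal e"
        using belowD(5)[OF x] belowD(5)[OF y] belowD(5)[OF z] e by (simp flip: ennreal_plus)
      also have "\<dots> \<le> inner_content V + ennreal e"
        by (intro add_right_mono le_inner_content z)
      finally show "ennreal (I x) + ennreal (I y) \<le> inner_content V + ennreal e" .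
    qed
    finally show "ennreal (I x) + outer (V - U) \<le> inner_content V + ennreal e" .
  qed
  then have "(SUP x\<in>below (V \<inter> U). ennreal (I x) + outer (V - U)) \<le> inner_content V"
    by (rule SUP_least)
  then show ?thesis
    unfolding inner_content_def[of "V \<inter> U"] using zero_below by (subst (asm) ennreal_SUP_add_left) auto
qed

lemma open_in_lambda_system:
  assumes U: "open U"
  shows "U \<in> lambda_system UNIV UNIV outer"
proof -
  have "outer (U \<inter> A) + outer (- U \<inter> A) = outer A" for A
  proof (rule antisym)
    show "outer (U \<inter> A) + outer (- U \<inter> A) \<le> outer A"
      unfolding outer_def[of A]
    proof (rule INF_greatest)
      fix V assume V: "V \<in> {V. open V \<and> A \<subseteq> V}"
      have "outer (U \<inter> A) + outer (- U \<inter> A) \<le> inner_content (V \<inter> U) + outer (V - U)"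
        using U V by (intro add_mono outer_le_inner_content outer_mono) auto
      also have "\<dots> \<le> inner_content V"
        using U V by (intro inner_content_ge_parts) auto
      finally show "outer (U \<inter> A) + outer (- U \<inter> A) \<le> inner_content V" .
    qed
    interpret P: sigma_algebra UNIV "UNIV :: 'a set set"
      using sigma_algebra_Pow[of "UNIV :: 'a set"] by simp
    have "subadditive UNIV outer"
      using outer_measure_space_outer
      by (auto simp: outer_measure_space_def intro: P.countably_subadditive_subadditive)
    then have "outer ((U \<inter> A) \<union> (- U \<inter> A)) \<le> outer (U \<inter> A) + outer (- U \<inter> A)"
      by (rule subadditiveD) auto
    also have "(U \<inter> A) \<union> (- U \<inter> A) = A" by blast
    finally show "outer A \<le> outer (U \<inter> A) + outer (- U \<inter> A)" .
  qed
  then show ?thesis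
    by (simp add: lambda_system_def Compl_eq_Diff_UNIV)
qed

section \<open>The representing measure\<close>

definition riesz_measure :: "'a measure" where
  "riesz_measure = measure_of UNIV (sets borel) outer"

lemma sets_riesz_measure [simp, measurable_cong]: "sets riesz_measure = sets borel"
  using sets.sigma_sets_eq[of "borel :: 'a measure"] by (simp add: riesz_measure_def)

lemma space_riesz_measure [simp]: "space riesz_measure = UNIV"
  by (simp add: riesz_measure_def)

lemma emeasure_riesz_measure:
  assumes "A \<in> sets borel"
  shows "emeasure riesz_measure A = outer A"
proof -
  define L where "L = lambda_system UNIV UNIV outer"
  interpret P: sigma_algebra UNIV "UNIV :: 'a set set"
    using sigma_algebra_Pow[of "UNIV :: 'a set"] by simp
  have L: "measure_space UNIV L outer"
    unfolding L_def using outer_measure_space_outer by (rule P.caratheodory_lemma)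
  then interpret L: sigma_algebra UNIV L
    by (simp add: measure_space_def)
  have "sets borel \<subseteq> L"
    unfolding borel_def using open_in_lambda_system
    by (auto simp: L_def[symmetric] intro!: L.sigma_sets_subset)
  then have "measure_space UNIV (sets borel) outer"
    using L sets.sigma_algebra_axioms[of "borel :: 'a measure"]
    by (auto simp: measure_space_def positive_def countably_additive_def)
  then show ?thesis
    unfolding riesz_measure_def measure_space_def
    using assms by (blast intro: emeasure_measure_of_sigma)
qed

lemma prob_space_riesz_measure: "prob_space riesz_measure"
  by (rule prob_spaceI) (simp add: emeasure_riesz_measure outer_open inner_content_UNIV)

lemma le_measure_riesz_measure:
  assumes "open U" "x \<in> below U"
  shows "I x \<le> measure riesz_measure U"
proof -
  interpret prob_space riesz_measure by (rule prob_space_riesz_measure)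
  have "ennreal (I x) \<le> emeasure riesz_measure U"
    using assms by (simp add: emeasure_riesz_measure outer_open le_inner_content)
  then show ?thesis
    by (simp add: emeasure_eq_measure)
qed

lemma bounded_range:
  fixes x :: "'a \<Rightarrow> real"
  assumes "continuous_on UNIV x"
  shows "bounded (range x)"
  using assms compact by (intro compact_imp_bounded compact_continuous_image)

lemma integrable_riesz_measure:
  fixes x :: "'a \<Rightarrow> real"
  assumes "continuous_on UNIV x"
  shows "integrable riesz_measure x"
  using assms
  by (intro integrable_bounded_continuous prob_space_riesz_measure sets_riesz_measure bounded_range)

text \<open>
  Cut \<open>x\<close> into \<open>n\<close> horizontal slices of height \<open>1 / n\<close>. The slice \<open>s k\<close>, scaled by \<open>n\<close>, lies below the
  open set \<open>U k\<close> where \<open>x > k / n\<close>, so \<open>I x\<close> is at most the sum of the measures of the \<open>U k\<close> divided by \<open>n\<close>. That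
  sum is the integral of a step function which exceeds \<open>x\<close> by at most \<open>1 / n\<close>.
\<close>

lemma le_integral_unit:
  assumes x: "x \<in> below UNIV"
  shows "I x \<le> (\<integral>t. x t \<partial>riesz_measure)"
proof (rule field_le_epsilon)
  interpret prob_space riesz_measure by (rule prob_space_riesz_measure)
  fix e :: real assume e: "0 < e"
  obtain n where n: "0 < n" "1 / real n < e"
    using e reals_Archimedean[OF e] by (metis inverse_eq_divide zero_less_Suc)
  note cx = belowD(1)[OF x]
  define s where "s k t = min (x t) (real (Suc k) / real n) - min (x t) (real k / real n)" for k t
  define U where "U k = {t. real k / real n < x t}" for k
  have cs: "continuous_on UNIV (s k)" for k
    unfolding s_def by (intro continuous_intros cx)
  have U: "open (U k)" for k
    unfolding U_def by (intro open_Collect_less continuous_intros cx)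
  have x_eq: "x = (\<lambda>t. \<Sum>k<n. s k t)"
  proof
    fix t
    have "(\<Sum>k<n. s k t) = min (x t) (real n / real n) - min (x t) (real 0 / real n)"
      unfolding s_def by (rule sum_lessThan_telescope)
    then show "x t = (\<Sum>k<n. s k t)"
      using n belowD(2,3)[OF x, of t] by simp
  qed
  have s_le: "I (s k) \<le> measure riesz_measure (U k) / n" for k
  proof -
    have step: "real (Suc k) / real n = real k / real n + 1 / real n"
      by (simp add: add_divide_distrib)
    have "(\<lambda>t. real n * s k t) \<in> below (U k)"
    proof (rule belowI)
      show "continuous_on UNIV (\<lambda>t. real n * s k t)"
        by (intro continuous_intros cs)
      have "0 < 1 / real n"
        using n by simp
      then have "0 \<le> s k t" "s k t \<le> 1 / real n" for t
        unfolding s_def step by linarith+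
      then show "0 \<le> real n * s k t" "real n * s k t \<le> 1" for t
        using n by (auto simp: field_simps)
      show "real n * s k t = 0" if "t \<notin> U k" for t
      proof -
        have "x t \<le> real k / real n" "0 < 1 / real n"
          using that n by (auto simp: U_def)
        then have "s k t = 0"
          unfolding s_def step by linarith
        then show ?thesis by simp
      qed
    qed
    from le_measure_riesz_measure[OF U this] show ?thesis
      using n scale[OF cs, of "real n" k] by (simp add: field_simps)
  qed
  have count: "(\<Sum>k<n. indicator (U k) t / n) \<le> x t + 1 / n" for t
  proof -
    \<comment> \<open>Raising \<open>x\<close> by one step makes every slice with \<open>x t > k / n\<close> a full one, so that a
      telescoping sum dominates the step function.\<close>
    define c where "c k = min (x t + 1 / n) (real k / real n)" for k :: nat
    have "indicator (U k) t / n \<le> c (Suc k) - c k" for k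
    proof -
      have step: "real (Suc k) / real n = real k / real n + 1 / real n" and "0 < 1 / real n"
        using n by (simp_all add: add_divide_distrib)
      then show ?thesis
        unfolding c_def step by (cases "t \<in> U k") (auto simp: U_def)
    qed
    then have "(\<Sum>k<n. indicator (U k) t / n) \<le> (\<Sum>k<n. c (Suc k) - c k)"
      by (rule sum_mono)
    also have "\<dots> = c n - c 0"
      by (rule sum_lessThan_telescope)
    also have "\<dots> \<le> x t + 1 / n"
      using belowD(2)[OF x, of t] by (simp add: c_def)
    finally show ?thesis .
  qed
  have "I x = (\<Sum>k<n. I (s k))"
    by (subst x_eq) (rule sum[OF cs])
  also have "\<dots> \<le> (\<Sum>k<n. measure riesz_measure (U k) / n)"
    by (intro sum_mono s_le)
  also have "\<dots> = (\<integral>t. (\<Sum>k<n. indicator (U k) t / n) \<partial>riesz_measure)"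
    using U by (subst Bochner_Integration.integral_sum) (auto simp: emeasure_eq_measure)
  also have "\<dots> \<le> (\<integral>t. x t + 1 / n \<partial>riesz_measure)"
  proof (rule integral_mono)
    show "integrable riesz_measure (\<lambda>t. \<Sum>k<n. indicator (U k) t / n)"
      using U by (intro Bochner_Integration.integrable_sum) (auto simp: emeasure_eq_measure)
    show "integrable riesz_measure (\<lambda>t. x t + 1 / n)"
      by (intro integrable_riesz_measure continuous_intros cx)
  qed (rule count)
  also have "\<dots> = (\<integral>t. x t \<partial>riesz_measure) + 1 / n"
    using integrable_riesz_measure[OF cx] by (simp add: prob_space[simplified])
  finally show "I x \<le> (\<integral>t. x t \<partial>riesz_measure) + e"
    using n by linarith
qed

lemma le_integral:
  assumes cx: "continuous_on UNIV x"
  shows "I x \<le> (\<integral>t. x t \<partial>riesz_measure)"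
proof -
  interpret prob_space riesz_measure by (rule prob_space_riesz_measure)
  obtain B where B: "0 < B" "\<And>t. \<bar>x t\<bar> \<le> B"
    using bounded_range[OF cx] by (auto simp: bounded_pos)
  \<comment> \<open>Both sides are affine in \<open>x\<close>, so \<open>x\<close> may be rescaled to take values between \<open>0\<close> and \<open>1\<close>.\<close>
  define y where "y t = (1 / (2 * B)) * (x t + B)" for t
  have "0 \<le> y t \<and> y t \<le> 1" for t
    using B(2)[of t] B(1) by (auto simp: y_def divide_simps)
  then have "y \<in> below UNIV"
    unfolding y_def by (intro belowI continuous_intros cx) auto
  then have "I y \<le> (\<integral>t. y t \<partial>riesz_measure)"
    by (rule le_integral_unit)
  moreover have "I y = (1 / (2 * B)) * (I x + B)"
    unfolding y_def using cx
    by (subst scale) (auto intro!: continuous_intros simp: add const)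
  moreover have "(\<integral>t. y t \<partial>riesz_measure) = (1 / (2 * B)) * ((\<integral>t. x t \<partial>riesz_measure) + B)"
    unfolding y_def using integrable_riesz_measure[OF cx]
    by (simp add: prob_space[simplified])
  ultimately show ?thesis
    using B(1) by (simp add: divide_simps)
qed

theorem riesz_representation:
  assumes cx: "continuous_on UNIV x"
  shows "I x = (\<integral>t. x t \<partial>riesz_measure)"
proof (rule antisym)
  show "I x \<le> (\<integral>t. x t \<partial>riesz_measure)"
    using cx by (rule le_integral)
  have "I (\<lambda>t. - x t) \<le> (\<integral>t. - x t \<partial>riesz_measure)"
    using cx by (intro le_integral continuous_intros)
  then show "(\<integral>t. x t \<partial>riesz_measure) \<le> I x"
    using scale[OF cx, of "-1"] by simp
qed

end

section \<open>Subgradients of the maximum functional\<close>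

lemma max_value_le:
  fixes f :: "'a::metric_space \<Rightarrow>\<^sub>C real"
  assumes K: "compact (UNIV :: 'a set)" and "\<And>t. apply_bcontfun f t \<le> c"
  shows "max_value f \<le> c"
  using max_value_attained[OF K, of f] assms(2) by auto

text \<open>
  Being concentrated on the maximizers is a single linear condition on the measure: \<open>max_value f - f\<close> is nonnegative
  and vanishes exactly on \<open>Argmax f\<close>, so its integral is \<open>0\<close> iff almost every point is a maximizer.
\<close>

lemma prob_measures_on_Argmax_iff:
  fixes f :: "'a::metric_space \<Rightarrow>\<^sub>C real"
  assumes K: "compact (UNIV :: 'a set)"
  shows "M \<in> prob_measures_on (Argmax f) \<longleftrightarrow>
    sets M = sets borel \<and> prob_space M \<and> (\<integral>t. apply_bcontfun f t \<partial>M) = max_value f"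
proof (cases "sets M = sets borel \<and> prob_space M")
  case True
  then interpret prob_space M by blast
  have sets: "sets M = sets borel" using True by blast
  have int: "integrable M (apply_bcontfun f)"
    using True by (intro integrable_bounded_continuous) auto
  have "closed (Argmax f)"
    unfolding Argmax_def by (intro closed_Collect_eq continuous_intros) auto
  then have meas: "Argmax f \<in> sets M" using sets by auto
  have "(\<integral>t. max_value f - apply_bcontfun f t \<partial>M) = 0 \<longleftrightarrow> (AE t in M. max_value f - apply_bcontfun f t = 0)"
    using int max_value_upper[OF K, of f]
    by (intro integral_nonneg_eq_0_iff_AE) auto
  moreover have "(AE t in M. max_value f - apply_bcontfun f t = 0) \<longleftrightarrow> (AE t in M. t \<in> Argmax f)"
    by (intro AE_cong) (auto simp: Argmax_def)
  moreover have "(\<integral>t. max_value f - apply_bcontfun f t \<partial>M) = max_value f - (\<integral>t. apply_bcontfun f t \<partial>M)"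
    using int by (simp add: prob_space)
  ultimately have iff: "(\<integral>t. apply_bcontfun f t \<partial>M) = max_value f \<longleftrightarrow> measure M (Argmax f) = 1"
    using prob_eq_1[OF meas] by auto
  have "measure M A = measure M (A \<inter> Argmax f)"
    if "measure M (Argmax f) = 1" "A \<in> sets borel" for A
  proof (rule finite_measure_eq_AE)
    have "AE t in M. t \<in> Argmax f" using that prob_eq_1[OF meas] by simp
    then show "AE t in M. t \<in> A \<longleftrightarrow> t \<in> A \<inter> Argmax f" by auto
  qed (use that meas sets in auto)
  then show ?thesis
    using True iff by (auto simp: prob_measures_on_def)
qed (auto simp: prob_measures_on_def)

lemma subgradient_positive_normalized:
  fixes f :: "'a::metric_space \<Rightarrow>\<^sub>C real"
  assumes K: "compact (UNIV :: 'a set)" and h: "h \<in> subdifferential max_value f"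
  shows "positive_normalized_functional (\<lambda>x. blinfun_apply h (Bcontfun x))"
    and "blinfun_apply h f = max_value f"
proof -
  have sub: "blinfun_apply h x \<le> max_value (f + x) - max_value f" for x
    using h[unfolded subdifferential_def] by (auto dest: spec[of _ "f + x"])
  have B: "apply_bcontfun (Bcontfun x) = x" if "continuous_on UNIV x" for x :: "'a \<Rightarrow> real"
    using that compact_imp_bounded[OF compact_continuous_image[OF that K]]
    by (intro Bcontfun_inverse) (auto simp: bcontfun_def)
  \<comment> \<open>Used for \<open>c = 1\<close> and \<open>c = -1\<close>, which together force the value on the constant \<open>1\<close>.\<close>
  have one_le: "c * blinfun_apply h (const_bcontfun 1) \<le> c" for c
  proof -
    have "blinfun_apply h (c *\<^sub>R const_bcontfun 1) \<le> max_value (f + c *\<^sub>R const_bcontfun 1) - max_value f"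
      by (rule sub)
    also have "max_value (f + c *\<^sub>R const_bcontfun 1) \<le> max_value f + c"
      using max_value_upper[OF K, of f]
      by (intro max_value_le K) auto
    finally show ?thesis
      by (simp add: blinfun.scaleR_right)
  qed
  show "positive_normalized_functional (\<lambda>x. blinfun_apply h (Bcontfun x))"
  proof
    fix x y :: "'a \<Rightarrow> real" and c :: real
    assume x: "continuous_on UNIV x"
    have "Bcontfun (\<lambda>t. c * x t) = c *\<^sub>R Bcontfun x"
      by (rule bcontfun_eqI) (simp add: B x continuous_on_mult_left)
    then show "blinfun_apply h (Bcontfun (\<lambda>t. c * x t)) = c * blinfun_apply h (Bcontfun x)"
      by (simp add: blinfun.scaleR_right)
    show "blinfun_apply h (Bcontfun (\<lambda>t. x t + y t)) = blinfun_apply h (Bcontfun x) + blinfun_apply h (Bcontfun y)"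
      if y: "continuous_on UNIV y"
    proof -
      have "Bcontfun (\<lambda>t. x t + y t) = Bcontfun x + Bcontfun y"
        by (rule bcontfun_eqI) (simp add: B x y continuous_on_add)
      then show ?thesis
        by (simp add: blinfun.add_right)
    qed
    show "0 \<le> blinfun_apply h (Bcontfun x)" if "\<And>t. 0 \<le> x t"
    proof -
      have "blinfun_apply h (- Bcontfun x) \<le> max_value (f + - Bcontfun x) - max_value f"
        by (rule sub)
      also have "max_value (f + - Bcontfun x) \<le> max_value f"
      proof (rule max_value_le[OF K])
        show "apply_bcontfun (f + - Bcontfun x) t \<le> max_value f" for t
          using max_value_upper[OF K, of f t] that[of t]
          by (simp add: B x)
      qed
      finally show ?thesis
        by (simp add: blinfun.minus_right)
    qed
  next
    have "Bcontfun (\<lambda>_::'a. 1::real) = const_bcontfun 1"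
      by (simp add: const_bcontfun_def)
    then show "blinfun_apply h (Bcontfun (\<lambda>_. 1)) = 1"
      using one_le[of 1] one_le[of "-1"] by simp
  qed (rule K)
  \<comment> \<open>Along the ray through \<open>f\<close> the maximum is linear; comparing \<open>f\<close> with \<open>2 f\<close> and with \<open>0\<close>
    bounds \<open>h f\<close> from both sides.\<close>
  have zero: "max_value (0 :: 'a \<Rightarrow>\<^sub>C real) = 0"
    using max_value_attained[OF K, of 0] by auto
  have "max_value (f + f) \<le> 2 * max_value f"
    using max_value_upper[OF K, of f]
    by (intro max_value_le K) (simp add: mult_2 [symmetric])
  then show "blinfun_apply h f = max_value f"
    using sub[of f] sub[of "- f"] zero by (simp add: blinfun.minus_right)
qed

theorem mainTheorem1:
  fixes f :: "'a::metric_space \<Rightarrow>\<^sub>C real"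
  assumes "compact (UNIV :: 'a set)"
  shows "subdifferential max_value f = prob_functionals f"
proof (intro set_eqI iffI)
  fix h assume h: "h \<in> subdifferential max_value f"
  interpret positive_normalized_functional "\<lambda>x. blinfun_apply h (Bcontfun x)"
    using assms h by (rule subgradient_positive_normalized)
  have rep: "blinfun_apply h x = (\<integral>t. apply_bcontfun x t \<partial>riesz_measure)" for x
    using riesz_representation[of "apply_bcontfun x"] by (simp add: apply_bcontfun_inverse)
  have "(\<integral>t. apply_bcontfun f t \<partial>riesz_measure) = max_value f"
    using rep[of f] subgradient_positive_normalized(2)[OF assms h] by argo
  then have "riesz_measure \<in> prob_measures_on (Argmax f)"
    unfolding prob_measures_on_Argmax_iff[OF assms]
    by (intro conjI sets_riesz_measure prob_space_riesz_measure)
  then show "h \<in> prob_functionals f"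
    unfolding prob_functionals_def using rep by blast
next
  fix h assume "h \<in> prob_functionals f"
  then obtain M where M: "sets M = sets borel" "prob_space M"
      "(\<integral>t. apply_bcontfun f t \<partial>M) = max_value f"
    and rep: "\<And>x. blinfun_apply h x = (\<integral>t. apply_bcontfun x t \<partial>M)"
    by (auto simp: prob_functionals_def prob_measures_on_Argmax_iff[OF assms])
  interpret prob_space M by fact
  have "blinfun_apply h (g - f) \<le> max_value g - max_value f" for g
  proof -
    have "blinfun_apply h g \<le> (\<integral>t. max_value g \<partial>M)"
      unfolding rep using M
      by (intro integral_mono integrable_bounded_continuous max_value_upper[OF assms]) auto
    then show ?thesis
      using rep[of f] M(3) by (simp add: blinfun.diff_right prob_space)
  qed
  then show "h \<in> subdifferential max_value f"
    by (simp add: subdifferential_def)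
qed

end
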